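(* Let $(A,\cdot_A,[\cdot,\cdot,\cdot]_A)$ and $(B,\cdot_B,[\cdot,\cdot,\cdot]_B)$ be two (finite-dimensional) Poisson 3-Lie algebras over a field $\mathbb F$ of characteristic zero, and let $\mu_A:A\to\mathfrak{gl}(B)$, $\rho_A:\otimes^2A\to\mathfrak{gl}(B)$, $\mu_B:B\to\mathfrak{gl}(A)$, $\rho_B:\otimes^2B\to\mathfrak{gl}(A)$ be linear maps. Define operations on $A\oplus B$ by $$(x+a)\cdot(y+b)=x\cdot_Ay+\mu_B(a)y+\mu_B(b)x+a\cdot_Bb+\mu_A(x)b+\mu_A(y)a,$$ $$[x_1+y_1,x_2+y_2,x_3+y_3]=[x_1,x_2,x_3]_A+\rho_A(x_1,x_2)y_3+\rho_A(x_3,x_1)y_2+\rho_A(x_2,x_3)y_1+[y_1,y_2,y_3]_B+\rho_B(y_1,y_2)x_3+\rho_B(y_3,y_1)x_2+\rho_B(y_2,y_3)x_1,$$ for $x,y,x_i\in A$ and $a,b,y_i\in B$. Then $(A\oplus B,\cdot,[\cdot,\cdot,\cdot])$ is a Poisson 3-Lie algebra if and only if $(A,B,\rho_A,\mu_A,\rho_B,\mu_B)$ is a matched pair of Poisson 3-Lie algebras.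
   Context: All vector spaces are finite-dimensional over a field $\mathbb F$ of characteristic zero; no unit is assumed in algebras. 3-Lie algebra: vector space with a skew-symmetric trilinear bracket satisfying $[x_1,x_2,[x_3,x_4,x_5]]=[[x_1,x_2,x_3],x_4,x_5]+[x_3,[x_1,x_2,x_4],x_5]+[x_3,x_4,[x_1,x_2,x_5]]$. Poisson 3-Lie algebra $(A,\cdot,[\cdot,\cdot,\cdot])$: $(A,\cdot)$ commutative associative, $(A,[\cdot,\cdot,\cdot])$ a 3-Lie algebra, and $[w\cdot x,y,z]=w\cdot[x,y,z]+x\cdot[w,y,z]$. A representation of a commutative associative algebra $(A,\cdot)$ on $V$: linear $\mu:A\to\mathfrak{gl}(V)$ with $\mu(x\cdot y)=\mu(x)\mu(y)$. A representation of a 3-Lie algebra on $V$: a skew-symmetric linear $\rho:\otimes^2A\to\mathfrak{gl}(V)$ with $\rho(x_1,x_2)\rho(x_3,x_4)-\rho(x_3,x_4)\rho(x_1,x_2)=\rho([x_1,x_2,x_3],x_4)-\rho([x_1,x_2,x_4],x_3)$ and $\rho([x_1,x_2,x_3],x_4)=\rho(x_1,x_2)\rho(x_3,x_4)+\rho(x_2,x_3)\rho(x_1,x_4)+\rho(x_3,x_1)\rho(x_2,x_4)$. A representation $(V,\rho,\mu)$ of a Poisson 3-Lie algebra: both of these together with $\rho(x\cdot y,z)=\mu(x)\rho(y,z)+\mu(y)\rho(x,z)$ and $\rho(x,y)\mu(z)=\mu([x,y,z])+\mu(z)\rho(x,y)$. Matched pair of commutative associative algebras $(A,B,\mu_A,\mu_B)$: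 $(B,\mu_A)$, $(A,\mu_B)$ are representations of $(A,\cdot_A)$, $(B,\cdot_B)$ and, for $x,y\in A$, $a,b\in B$, $\mu_A(x)(a\cdot_Bb)=(\mu_A(x)a)\cdot_Bb+\mu_A(\mu_B(a)x)b$ and $\mu_B(a)(x\cdot_Ay)=(\mu_B(a)x)\cdot_Ay+\mu_B(\mu_A(x)a)y$. Matched pair of 3-Lie algebras $(A,B,\rho_A,\rho_B)$: $(B,\rho_A)$, $(A,\rho_B)$ are representations of the 3-Lie algebras $A$, $B$ and for $x_i\in A$, $y_i\in B$: $\rho_B(y_4,y_5)[x_1,x_2,x_3]_A=[\rho_B(y_4,y_5)x_1,x_2,x_3]_A+[x_1,\rho_B(y_4,y_5)x_2,x_3]_A+[x_1,x_2,\rho_B(y_4,y_5)x_3]_A$; $-\rho_B(\rho_A(x_1,x_2)y_3,y_5)x_4=-\rho_B(\rho_A(x_1,x_4)y_5,y_3)x_2+\rho_B(\rho_A(x_2,x_4)y_5,y_3)x_1-[x_1,x_2,\rho_B(y_3,y_5)x_4]_A$; $[\rho_B(y_2,y_3)x_1,x_4,x_5]_A=\rho_B(y_2,y_3)[x_1,x_4,x_5]_A+\rho_B(\rho_A(x_4,x_5)y_2,y_3)x_1+\rho_B(y_2,\rho_A(x_4,x_5)y_3)x_1$; and the three identities obtained by exchanging the roles of $A$ and $B$ (i.e. $x\leftrightarrow y$, $A\leftrightarrow B$). Matched pair of Poisson 3-Lie algebras $(A,B,\rho_A,\mu_A,\rho_B,\mu_B)$ ($A,B$ Poisson 3-Lie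 algebras): $(A,B,\mu_A,\mu_B)$ is a matched pair of commutative associative algebras, $(A,B,\rho_A,\rho_B)$ is a matched pair of 3-Lie algebras, $(B,\rho_A,\mu_A)$ and $(A,\rho_B,\mu_B)$ are representations of the Poisson 3-Lie algebras $A$ and $B$, and for $x_i\in A,y_i\in B$: $[\mu_B(y_1)x_1,x_2,x_3]_A=\mu_B(\rho_A(x_2,x_3)y_1)x_1+\mu_B(y_1)[x_1,x_2,x_3]_A$; $[\mu_A(x_1)y_1,y_2,y_3]_B=\mu_A(\rho_B(y_2,y_3)x_1)y_1+\mu_A(x_1)[y_1,y_2,y_3]_B$; $\rho_B(\mu_A(x_1)y_1,y_2)x_2=x_1\cdot_A(\rho_B(y_1,y_2)x_2)$; $\rho_A(\mu_B(y_1)x_1,x_2)y_2=y_1\cdot_B(\rho_A(x_1,x_2)y_2)$; $\mu_B(\rho_A(x_1,x_2)y_1)x_3+\mu_B(\rho_A(x_3,x_2)y_1)x_1=0$; $\mu_A(\rho_B(y_1,y_2)x_1)y_3+\mu_A(\rho_B(y_3,y_2)x_1)y_1=0$; $\rho_B(y_3,y_4)(x_1\cdot_Ax_2)=x_1\cdot_A(\rho_B(y_3,y_4)x_2)+x_2\cdot_A(\rho_B(y_3,y_4)x_1)$; $\rho_A(x_3,x_4)(y_1\cdot_By_2)=y_1\cdot_B(\rho_A(x_3,x_4)y_2)+y_2\cdot_B(\rho_A(x_3,x_4)y_1)$. *)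

theory Defs
  imports "HOL-Analysis.Product_Vector"
begin

locale fd_vector_space = vector_space scale
  for scale :: "'k::field_char_0 \<Rightarrow> 'v::ab_group_add \<Rightarrow> 'v" +
  assumes finite_dim: "\<exists>Basis. finite_dimensional_vector_space scale Basis"

text \<open>
  A linear map \<open>U \<rightarrow> gl(V)\<close> is encoded as a bilinear map \<open>U \<times> V \<rightarrow> V\<close>, and a linear map
  \<open>U \<otimes> U \<rightarrow> gl(V)\<close> as a trilinear map \<open>U \<times> U \<times> V \<rightarrow> V\<close>.
\<close>

definition bilinear_map ::
  "('k::field \<Rightarrow> 'a::ab_group_add \<Rightarrow> 'a) \<Rightarrow> ('k \<Rightarrow> 'b::ab_group_add \<Rightarrow> 'b) \<Rightarrow>
   ('k \<Rightarrow> 'c::ab_group_add \<Rightarrow> 'c) \<Rightarrow> ('a \<Rightarrow> 'b \<Rightarrow> 'c) \<Rightarrow> bool"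
  where "bilinear_map s1 s2 s3 f \<longleftrightarrow>
    (\<forall>y. Vector_Spaces.linear s1 s3 (\<lambda>x. f x y)) \<and>
    (\<forall>x. Vector_Spaces.linear s2 s3 (\<lambda>y. f x y))"

definition trilinear_map ::
  "('k::field \<Rightarrow> 'a::ab_group_add \<Rightarrow> 'a) \<Rightarrow> ('k \<Rightarrow> 'b::ab_group_add \<Rightarrow> 'b) \<Rightarrow>
   ('k \<Rightarrow> 'c::ab_group_add \<Rightarrow> 'c) \<Rightarrow> ('k \<Rightarrow> 'd::ab_group_add \<Rightarrow> 'd) \<Rightarrow>
   ('a \<Rightarrow> 'b \<Rightarrow> 'c \<Rightarrow> 'd) \<Rightarrow> bool"
  where "trilinear_map s1 s2 s3 s4 f \<longleftrightarrow>
    (\<forall>y z. Vector_Spaces.linear s1 s4 (\<lambda>x. f x y z)) \<and>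
    (\<forall>x z. Vector_Spaces.linear s2 s4 (\<lambda>y. f x y z)) \<and>
    (\<forall>x y. Vector_Spaces.linear s3 s4 (\<lambda>z. f x y z))"

locale comm_assoc_algebra = fd_vector_space scale
  for scale :: "'k::field_char_0 \<Rightarrow> 'a::ab_group_add \<Rightarrow> 'a" +
  fixes mul :: "'a \<Rightarrow> 'a \<Rightarrow> 'a"  (infixl \<open>\<cdot>\<close> 70)
  assumes mul_bilinear: "bilinear_map scale scale scale mul"
    and mul_assoc: "(x \<cdot> y) \<cdot> z = x \<cdot> (y \<cdot> z)"
    and mul_comm: "x \<cdot> y = y \<cdot> x"

text \<open>
  Skew-symmetry under the full symmetric group is stated for the two adjacent transpositions,
  which generate it.
\<close>

locale three_Lie_algebra = fd_vector_space scale
  for scale :: "'k::field_char_0 \<Rightarrow> 'a::ab_group_add \<Rightarrow> 'a" +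
  fixes br :: "'a \<Rightarrow> 'a \<Rightarrow> 'a \<Rightarrow> 'a"
  assumes br_trilinear: "trilinear_map scale scale scale scale br"
    and br_skew12: "br x y z = - br y x z"
    and br_skew23: "br x y z = - br x z y"
    and br_fundamental: "br x1 x2 (br x3 x4 x5) =
      br (br x1 x2 x3) x4 x5 + br x3 (br x1 x2 x4) x5 + br x3 x4 (br x1 x2 x5)"

locale Poisson_three_Lie_algebra =
  comm_assoc_algebra scale mul + three_Lie_algebra scale br
  for scale :: "'k::field_char_0 \<Rightarrow> 'a::ab_group_add \<Rightarrow> 'a"
    and mul :: "'a \<Rightarrow> 'a \<Rightarrow> 'a"  (infixl \<open>\<cdot>\<close> 70)
    and br :: "'a \<Rightarrow> 'a \<Rightarrow> 'a \<Rightarrow> 'a" +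
  assumes Leibniz: "br (w \<cdot> x) y z = w \<cdot> br x y z + x \<cdot> br w y z"

locale comm_assoc_rep =
  alg: comm_assoc_algebra scale mul + V: fd_vector_space scaleV
  for scale :: "'k::field_char_0 \<Rightarrow> 'a::ab_group_add \<Rightarrow> 'a"
    and mul :: "'a \<Rightarrow> 'a \<Rightarrow> 'a"  (infixl \<open>\<cdot>\<close> 70)
    and scaleV :: "'k \<Rightarrow> 'v::ab_group_add \<Rightarrow> 'v" +
  fixes \<mu> :: "'a \<Rightarrow> 'v \<Rightarrow> 'v"
  assumes mu_linear: "bilinear_map scale scaleV scaleV \<mu>"
    and mu_mul: "\<mu> (x \<cdot> y) v = \<mu> x (\<mu> y v)"

locale three_Lie_rep =
  alg: three_Lie_algebra scale br + V: fd_vector_space scaleV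
  for scale :: "'k::field_char_0 \<Rightarrow> 'a::ab_group_add \<Rightarrow> 'a"
    and br :: "'a \<Rightarrow> 'a \<Rightarrow> 'a \<Rightarrow> 'a"
    and scaleV :: "'k \<Rightarrow> 'v::ab_group_add \<Rightarrow> 'v" +
  fixes \<rho> :: "'a \<Rightarrow> 'a \<Rightarrow> 'v \<Rightarrow> 'v"
  assumes rho_linear: "trilinear_map scale scale scaleV scaleV \<rho>"
    and rho_skew: "\<rho> x y v = - \<rho> y x v"
    and rho_commutator: "\<rho> x1 x2 (\<rho> x3 x4 v) - \<rho> x3 x4 (\<rho> x1 x2 v) =
      \<rho> (br x1 x2 x3) x4 v - \<rho> (br x1 x2 x4) x3 v"
    and rho_br: "\<rho> (br x1 x2 x3) x4 v =
      \<rho> x1 x2 (\<rho> x3 x4 v) + \<rho> x2 x3 (\<rho> x1 x4 v) + \<rho> x3 x1 (\<rho> x2 x4 v)"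

locale Poisson_three_Lie_rep =
  alg: Poisson_three_Lie_algebra scale mul br +
  assoc: comm_assoc_rep scale mul scaleV \<mu> +
  Lie: three_Lie_rep scale br scaleV \<rho>
  for scale :: "'k::field_char_0 \<Rightarrow> 'a::ab_group_add \<Rightarrow> 'a"
    and mul :: "'a \<Rightarrow> 'a \<Rightarrow> 'a"  (infixl \<open>\<cdot>\<close> 70)
    and br :: "'a \<Rightarrow> 'a \<Rightarrow> 'a \<Rightarrow> 'a"
    and scaleV :: "'k \<Rightarrow> 'v::ab_group_add \<Rightarrow> 'v"
    and \<rho> :: "'a \<Rightarrow> 'a \<Rightarrow> 'v \<Rightarrow> 'v"
    and \<mu> :: "'a \<Rightarrow> 'v \<Rightarrow> 'v" +
  assumes rho_mul: "\<rho> (x \<cdot> y) z v = \<mu> x (\<rho> y z v) + \<mu> y (\<rho> x z v)"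
    and rho_mu: "\<rho> x y (\<mu> z v) = \<mu> (br x y z) v + \<mu> z (\<rho> x y v)"

locale comm_assoc_matched_pair =
  A: comm_assoc_rep scaleA mulA scaleB \<mu>\<^sub>A +
  B: comm_assoc_rep scaleB mulB scaleA \<mu>\<^sub>B
  for scaleA :: "'k::field_char_0 \<Rightarrow> 'a::ab_group_add \<Rightarrow> 'a"
    and mulA :: "'a \<Rightarrow> 'a \<Rightarrow> 'a"  (infixl \<open>\<cdot>\<^sub>A\<close> 70)
    and scaleB :: "'k \<Rightarrow> 'b::ab_group_add \<Rightarrow> 'b"
    and mulB :: "'b \<Rightarrow> 'b \<Rightarrow> 'b"  (infixl \<open>\<cdot>\<^sub>B\<close> 70)
    and \<mu>\<^sub>A :: "'a \<Rightarrow> 'b \<Rightarrow> 'b"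
    and \<mu>\<^sub>B :: "'b \<Rightarrow> 'a \<Rightarrow> 'a" +
  assumes muA_mulB: "\<mu>\<^sub>A x (a \<cdot>\<^sub>B b) = \<mu>\<^sub>A x a \<cdot>\<^sub>B b + \<mu>\<^sub>A (\<mu>\<^sub>B a x) b"
    and muB_mulA: "\<mu>\<^sub>B a (x \<cdot>\<^sub>A y) = \<mu>\<^sub>B a x \<cdot>\<^sub>A y + \<mu>\<^sub>B (\<mu>\<^sub>A x a) y"

locale three_Lie_matched_pair =
  A: three_Lie_rep scaleA brA scaleB \<rho>\<^sub>A +
  B: three_Lie_rep scaleB brB scaleA \<rho>\<^sub>B
  for scaleA :: "'k::field_char_0 \<Rightarrow> 'a::ab_group_add \<Rightarrow> 'a"
    and brA :: "'a \<Rightarrow> 'a \<Rightarrow> 'a \<Rightarrow> 'a"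
    and scaleB :: "'k \<Rightarrow> 'b::ab_group_add \<Rightarrow> 'b"
    and brB :: "'b \<Rightarrow> 'b \<Rightarrow> 'b \<Rightarrow> 'b"
    and \<rho>\<^sub>A :: "'a \<Rightarrow> 'a \<Rightarrow> 'b \<Rightarrow> 'b"
    and \<rho>\<^sub>B :: "'b \<Rightarrow> 'b \<Rightarrow> 'a \<Rightarrow> 'a" +
  assumes rhoB_brA: "\<rho>\<^sub>B y4 y5 (brA x1 x2 x3) =
      brA (\<rho>\<^sub>B y4 y5 x1) x2 x3 + brA x1 (\<rho>\<^sub>B y4 y5 x2) x3 + brA x1 x2 (\<rho>\<^sub>B y4 y5 x3)"
    and rhoB_rhoA: "- \<rho>\<^sub>B (\<rho>\<^sub>A x1 x2 y3) y5 x4 =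
      - \<rho>\<^sub>B (\<rho>\<^sub>A x1 x4 y5) y3 x2 + \<rho>\<^sub>B (\<rho>\<^sub>A x2 x4 y5) y3 x1 - brA x1 x2 (\<rho>\<^sub>B y3 y5 x4)"
    and brA_rhoB: "brA (\<rho>\<^sub>B y2 y3 x1) x4 x5 =
      \<rho>\<^sub>B y2 y3 (brA x1 x4 x5) + \<rho>\<^sub>B (\<rho>\<^sub>A x4 x5 y2) y3 x1 + \<rho>\<^sub>B y2 (\<rho>\<^sub>A x4 x5 y3) x1"
    and rhoA_brB: "\<rho>\<^sub>A x4 x5 (brB y1 y2 y3) =
      brB (\<rho>\<^sub>A x4 x5 y1) y2 y3 + brB y1 (\<rho>\<^sub>A x4 x5 y2) y3 + brB y1 y2 (\<rho>\<^sub>A x4 x5 y3)"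
    and rhoA_rhoB: "- \<rho>\<^sub>A (\<rho>\<^sub>B y1 y2 x3) x5 y4 =
      - \<rho>\<^sub>A (\<rho>\<^sub>B y1 y4 x5) x3 y2 + \<rho>\<^sub>A (\<rho>\<^sub>B y2 y4 x5) x3 y1 - brB y1 y2 (\<rho>\<^sub>A x3 x5 y4)"
    and brB_rhoA: "brB (\<rho>\<^sub>A x2 x3 y1) y4 y5 =
      \<rho>\<^sub>A x2 x3 (brB y1 y4 y5) + \<rho>\<^sub>A (\<rho>\<^sub>B y4 y5 x2) x3 y1 + \<rho>\<^sub>A x2 (\<rho>\<^sub>B y4 y5 x3) y1"

locale Poisson_three_Lie_matched_pair =
  A: Poisson_three_Lie_rep scaleA mulA brA scaleB \<rho>\<^sub>A \<mu>\<^sub>A +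
  B: Poisson_three_Lie_rep scaleB mulB brB scaleA \<rho>\<^sub>B \<mu>\<^sub>B +
  assoc: comm_assoc_matched_pair scaleA mulA scaleB mulB \<mu>\<^sub>A \<mu>\<^sub>B +
  Lie: three_Lie_matched_pair scaleA brA scaleB brB \<rho>\<^sub>A \<rho>\<^sub>B
  for scaleA :: "'k::field_char_0 \<Rightarrow> 'a::ab_group_add \<Rightarrow> 'a"
    and mulA :: "'a \<Rightarrow> 'a \<Rightarrow> 'a"  (infixl \<open>\<cdot>\<^sub>A\<close> 70)
    and brA :: "'a \<Rightarrow> 'a \<Rightarrow> 'a \<Rightarrow> 'a"
    and scaleB :: "'k \<Rightarrow> 'b::ab_group_add \<Rightarrow> 'b"
    and mulB :: "'b \<Rightarrow> 'b \<Rightarrow> 'b"  (infixl \<open>\<cdot>\<^sub>B\<close> 70)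
    and brB :: "'b \<Rightarrow> 'b \<Rightarrow> 'b \<Rightarrow> 'b"
    and \<rho>\<^sub>A :: "'a \<Rightarrow> 'a \<Rightarrow> 'b \<Rightarrow> 'b"
    and \<mu>\<^sub>A :: "'a \<Rightarrow> 'b \<Rightarrow> 'b"
    and \<rho>\<^sub>B :: "'b \<Rightarrow> 'b \<Rightarrow> 'a \<Rightarrow> 'a"
    and \<mu>\<^sub>B :: "'b \<Rightarrow> 'a \<Rightarrow> 'a" +
  assumes brA_muB: "brA (\<mu>\<^sub>B y1 x1) x2 x3 = \<mu>\<^sub>B (\<rho>\<^sub>A x2 x3 y1) x1 + \<mu>\<^sub>B y1 (brA x1 x2 x3)"
    and brB_muA: "brB (\<mu>\<^sub>A x1 y1) y2 y3 = \<mu>\<^sub>A (\<rho>\<^sub>B y2 y3 x1) y1 + \<mu>\<^sub>A x1 (brB y1 y2 y3)"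
    and rhoB_muA: "\<rho>\<^sub>B (\<mu>\<^sub>A x1 y1) y2 x2 = x1 \<cdot>\<^sub>A \<rho>\<^sub>B y1 y2 x2"
    and rhoA_muB: "\<rho>\<^sub>A (\<mu>\<^sub>B y1 x1) x2 y2 = y1 \<cdot>\<^sub>B \<rho>\<^sub>A x1 x2 y2"
    and muB_rhoA: "\<mu>\<^sub>B (\<rho>\<^sub>A x1 x2 y1) x3 + \<mu>\<^sub>B (\<rho>\<^sub>A x3 x2 y1) x1 = 0"
    and muA_rhoB: "\<mu>\<^sub>A (\<rho>\<^sub>B y1 y2 x1) y3 + \<mu>\<^sub>A (\<rho>\<^sub>B y3 y2 x1) y1 = 0"
    and rhoB_mulA: "\<rho>\<^sub>B y3 y4 (x1 \<cdot>\<^sub>A x2) = x1 \<cdot>\<^sub>A \<rho>\<^sub>B y3 y4 x2 + x2 \<cdot>\<^sub>A \<rho>\<^sub>B y3 y4 x1"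
    and rhoA_mulB: "\<rho>\<^sub>A x3 x4 (y1 \<cdot>\<^sub>B y2) = y1 \<cdot>\<^sub>B \<rho>\<^sub>A x3 x4 y2 + y2 \<cdot>\<^sub>B \<rho>\<^sub>A x3 x4 y1"

text \<open>
  The direct sum \<open>A \<oplus> B\<close> is the product type, with \<open>x + a\<close> written \<open>(x, a)\<close> and scalar
  multiplication \<^const>\<open>module_prod.scale\<close>.
\<close>

definition direct_sum_mul ::
  "('a::ab_group_add \<Rightarrow> 'a \<Rightarrow> 'a) \<Rightarrow> ('b::ab_group_add \<Rightarrow> 'b \<Rightarrow> 'b) \<Rightarrow>
   ('a \<Rightarrow> 'b \<Rightarrow> 'b) \<Rightarrow> ('b \<Rightarrow> 'a \<Rightarrow> 'a) \<Rightarrow> 'a \<times> 'b \<Rightarrow> 'a \<times> 'b \<Rightarrow> 'a \<times> 'b"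
  where "direct_sum_mul mulA mulB \<mu>\<^sub>A \<mu>\<^sub>B = (\<lambda>(x, a) (y, b).
    (mulA x y + \<mu>\<^sub>B a y + \<mu>\<^sub>B b x,
     mulB a b + \<mu>\<^sub>A x b + \<mu>\<^sub>A y a))"

definition direct_sum_br ::
  "('a::ab_group_add \<Rightarrow> 'a \<Rightarrow> 'a \<Rightarrow> 'a) \<Rightarrow> ('b::ab_group_add \<Rightarrow> 'b \<Rightarrow> 'b \<Rightarrow> 'b) \<Rightarrow>
   ('a \<Rightarrow> 'a \<Rightarrow> 'b \<Rightarrow> 'b) \<Rightarrow> ('b \<Rightarrow> 'b \<Rightarrow> 'a \<Rightarrow> 'a) \<Rightarrow>
   'a \<times> 'b \<Rightarrow> 'a \<times> 'b \<Rightarrow> 'a \<times> 'b \<Rightarrow> 'a \<times> 'b"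
  where "direct_sum_br brA brB \<rho>\<^sub>A \<rho>\<^sub>B = (\<lambda>(x1, y1) (x2, y2) (x3, y3).
    (brA x1 x2 x3 + \<rho>\<^sub>B y1 y2 x3 + \<rho>\<^sub>B y3 y1 x2 + \<rho>\<^sub>B y2 y3 x1,
     brB y1 y2 y3 + \<rho>\<^sub>A x1 x2 y3 + \<rho>\<^sub>A x3 x1 y2 + \<rho>\<^sub>A x2 x3 y1))"

end

theory Submission
  imports Defs
begin

text \<open>
  Both sides of the associativity, fundamental and Leibniz identities are additive in every
  argument, so on \<open>A \<oplus> B\<close> they hold as soon as they hold on homogeneous elements, that is, on elements
  of \<open>A\<close> and \<open>B\<close>. By the symmetries of the operations only finitely many distributions of
  the arguments over \<open>A\<close> and \<open>B\<close> remain, and for each mixed one the \<open>A\<close>- and \<open>B\<close>-components of the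
  identity are exactly axioms of a matched pair.
\<close>

section \<open>Evaluation rules for bilinear and trilinear maps, and the vector space on the direct
  sum\<close>

lemma bilinear_map_simps:
  assumes "bilinear_map s1 s2 s3 f"
  shows "f (x + x') y = f x y + f x' y" and "f x (y + y') = f x y + f x y'"
    and "f 0 y = 0" and "f x 0 = 0"
    and "f (- x) y = - f x y" and "f x (- y) = - f x y"
proof -
  have l: "module_hom s1 s3 (\<lambda>x. f x y)" for y
    using assms by (simp add: bilinear_map_def module_hom_iff_linear)
  have r: "module_hom s2 s3 (f x)" for x
    using assms by (simp add: bilinear_map_def module_hom_iff_linear)
  show "f (x + x') y = f x y + f x' y" "f 0 y = 0" "f (- x) y = - f x y"
    using l[THEN module_hom.add] l[THEN module_hom.zero] l[THEN module_hom.neg] by blast+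
  show "f x (y + y') = f x y + f x y'" "f x 0 = 0" "f x (- y) = - f x y"
    using r[THEN module_hom.add] r[THEN module_hom.zero] r[THEN module_hom.neg] by blast+
qed

lemma trilinear_map_simps:
  assumes "trilinear_map s1 s2 s3 s4 f"
  shows "f (x + x') y z = f x y z + f x' y z" and "f x (y + y') z = f x y z + f x y' z"
    and "f x y (z + z') = f x y z + f x y z'"
    and "f 0 y z = 0" and "f x 0 z = 0" and "f x y 0 = 0"
    and "f (- x) y z = - f x y z" and "f x (- y) z = - f x y z" and "f x y (- z) = - f x y z"
proof -
  have 1: "module_hom s1 s4 (\<lambda>x. f x y z)" for y z
    using assms by (simp add: trilinear_map_def module_hom_iff_linear)
  have 2: "module_hom s2 s4 (\<lambda>y. f x y z)" for x z
    using assms by (simp add: trilinear_map_def module_hom_iff_linear)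
  have 3: "module_hom s3 s4 (f x y)" for x y
    using assms by (simp add: trilinear_map_def module_hom_iff_linear)
  show "f (x + x') y z = f x y z + f x' y z" "f 0 y z = 0" "f (- x) y z = - f x y z"
    using 1[THEN module_hom.add] 1[THEN module_hom.zero] 1[THEN module_hom.neg] by blast+
  show "f x (y + y') z = f x y z + f x y' z" "f x 0 z = 0" "f x (- y) z = - f x y z"
    using 2[THEN module_hom.add] 2[THEN module_hom.zero] 2[THEN module_hom.neg] by blast+
  show "f x y (z + z') = f x y z + f x y z'" "f x y 0 = 0" "f x y (- z) = - f x y z"
    using 3[THEN module_hom.add] 3[THEN module_hom.zero] 3[THEN module_hom.neg] by blast+
qed

lemma bilinear_map_scale:
  assumes "bilinear_map s1 s2 s3 f"
  shows "f (s1 c x) y = s3 c (f x y)" and "f x (s2 c y) = s3 c (f x y)"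
  using assms by (simp_all add: bilinear_map_def Vector_Spaces.linear_iff)

lemma trilinear_map_scale:
  assumes "trilinear_map s1 s2 s3 s4 f"
  shows "f (s1 c x) y z = s4 c (f x y z)" and "f x (s2 c y) z = s4 c (f x y z)"
    and "f x y (s3 c z) = s4 c (f x y z)"
  using assms by (simp_all add: trilinear_map_def Vector_Spaces.linear_iff)

lemma fd_vector_space_prod:
  assumes "fd_vector_space s1" and "fd_vector_space s2"
  shows "fd_vector_space (module_prod.scale s1 s2)"
proof -
  \<comment> \<open>The product of finite-dimensional spaces is parametrised by bases of both
    factors, so explicit bases are extracted first.\<close>
  obtain B1 where "finite_dimensional_vector_space s1 B1"
    using assms(1) fd_vector_space.finite_dim by blast
  then interpret V1: finite_dimensional_vector_space s1 B1 .
  obtain B2 where "finite_dimensional_vector_space s2 B2"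
    using assms(2) fd_vector_space.finite_dim by blast
  then interpret V2: finite_dimensional_vector_space s2 B2 .
  interpret V: finite_dimensional_vector_space_prod s1 s2 B1 B2 ..
  show ?thesis
    by unfold_locales (use V.p.finite_dimensional_vector_space_axioms in blast)
qed

section \<open>Reduction of multilinear identities to homogeneous elements\<close>

definition homogeneous :: "('a::zero \<times> 'b::zero) set"
  where "homogeneous = range (\<lambda>x. (x, 0)) \<union> range (\<lambda>y. (0, y))"

text \<open>Every pair is \<open>(x, 0) + (0, y)\<close>. The rule removes the homogeneity
  restriction from a single argument of an identity that is additive in it.\<close>

lemma homogeneous_additive_induct:
  fixes p :: "'a::ab_group_add \<times> 'b::ab_group_add"
  assumes "\<And>p q. P p \<Longrightarrow> P q \<Longrightarrow> P (p + q)" and "\<And>p. p \<in> homogeneous \<Longrightarrow> P p"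
  shows "P p"
proof (cases p)
  case (Pair x y)
  have "P ((x, 0) + (0, y))" by (intro assms) (auto simp: homogeneous_def)
  then show ?thesis using Pair by simp
qed

definition fundamental :: "('v::ab_group_add \<Rightarrow> 'v \<Rightarrow> 'v \<Rightarrow> 'v) \<Rightarrow> 'v \<Rightarrow> 'v \<Rightarrow> 'v \<Rightarrow> 'v \<Rightarrow> 'v \<Rightarrow> bool"
  where "fundamental br x1 x2 x3 x4 x5 \<longleftrightarrow> br x1 x2 (br x3 x4 x5) =
    br (br x1 x2 x3) x4 x5 + br x3 (br x1 x2 x4) x5 + br x3 x4 (br x1 x2 x5)"

text \<open>
  The labels record to which summand the arguments belong: \<open>AB_AAB\<close> stands for the identity with
  \<open>p1, p3, p4\<close> in \<open>A\<close> and \<open>p2, p5\<close> in \<open>B\<close>. The identity is skew in \<open>p1, p2\<close> and in \<open>p3, p4, p5\<close>.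
\<close>

lemma fundamental_prodI:
  fixes br :: "'a::ab_group_add \<times> 'b::ab_group_add \<Rightarrow> 'a \<times> 'b \<Rightarrow> 'a \<times> 'b \<Rightarrow> 'a \<times> 'b"
  assumes lin: "trilinear_map s s s s br"
    and skew12: "\<And>p q r. br p q r = - br q p r" and skew23: "\<And>p q r. br p q r = - br p r q"
    and AA_AAA: "\<And>x1 x2 x3 x4 x5. fundamental br (x1, 0) (x2, 0) (x3, 0) (x4, 0) (x5, 0)"
    and AA_AAB: "\<And>x1 x2 x3 x4 y5. fundamental br (x1, 0) (x2, 0) (x3, 0) (x4, 0) (0, y5)"
    and AA_ABB: "\<And>x1 x2 x3 y4 y5. fundamental br (x1, 0) (x2, 0) (x3, 0) (0, y4) (0, y5)"
    and AA_BBB: "\<And>x1 x2 y3 y4 y5. fundamental br (x1, 0) (x2, 0) (0, y3) (0, y4) (0, y5)"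
    and AB_AAA: "\<And>x1 y2 x3 x4 x5. fundamental br (x1, 0) (0, y2) (x3, 0) (x4, 0) (x5, 0)"
    and AB_AAB: "\<And>x1 y2 x3 x4 y5. fundamental br (x1, 0) (0, y2) (x3, 0) (x4, 0) (0, y5)"
    and AB_ABB: "\<And>x1 y2 x3 y4 y5. fundamental br (x1, 0) (0, y2) (x3, 0) (0, y4) (0, y5)"
    and AB_BBB: "\<And>x1 y2 y3 y4 y5. fundamental br (x1, 0) (0, y2) (0, y3) (0, y4) (0, y5)"
    and BB_AAA: "\<And>y1 y2 x3 x4 x5. fundamental br (0, y1) (0, y2) (x3, 0) (x4, 0) (x5, 0)"
    and BB_AAB: "\<And>y1 y2 x3 x4 y5. fundamental br (0, y1) (0, y2) (x3, 0) (x4, 0) (0, y5)"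
    and BB_ABB: "\<And>y1 y2 x3 y4 y5. fundamental br (0, y1) (0, y2) (x3, 0) (0, y4) (0, y5)"
    and BB_BBB: "\<And>y1 y2 y3 y4 y5. fundamental br (0, y1) (0, y2) (0, y3) (0, y4) (0, y5)"
  shows "fundamental br p1 p2 p3 p4 p5"
proof -
  note add = trilinear_map_simps(1-3)[OF lin]
  note neg = trilinear_map_simps(7-9)[OF lin]
  \<comment> \<open>Each of the four terms contains one inner or outer bracket starting with
    \<open>p1 p2\<close>, so the exchange negates both sides.\<close>
  have swap12: "fundamental br p2 p1 p3 p4 p5" if "fundamental br p1 p2 p3 p4 p5" for p1 p2 p3 p4 p5
    using that unfolding fundamental_def
    by (simp add: skew12[of p2 p1] neg)
  \<comment> \<open>Both sides change sign: on the right, the first two terms trade places up to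
    sign and the third is only negated.\<close>
  have swap34: "fundamental br p1 p2 p4 p3 p5" if "fundamental br p1 p2 p3 p4 p5" for p1 p2 p3 p4 p5
  proof -
    have "br p1 p2 (br p4 p3 p5) = - br p1 p2 (br p3 p4 p5)"
      by (simp add: skew12[of p4 p3] neg)
    also have "\<dots> = - br (br p1 p2 p3) p4 p5 - br p3 (br p1 p2 p4) p5 - br p3 p4 (br p1 p2 p5)"
      using that by (simp add: fundamental_def)
    also have "\<dots> = br p4 (br p1 p2 p3) p5 + br (br p1 p2 p4) p3 p5 + br p4 p3 (br p1 p2 p5)"
      using skew12[of p4 "br p1 p2 p3"] skew12[of "br p1 p2 p4" p3] skew12[of p4 p3] by simp
    finally show ?thesis by (simp add: fundamental_def add.commute)
  qed
  \<comment> \<open>Now the last two terms on the right trade places up to sign, and the first is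
    only negated.\<close>
  have swap45: "fundamental br p1 p2 p3 p5 p4" if "fundamental br p1 p2 p3 p4 p5" for p1 p2 p3 p4 p5
  proof -
    have "br p1 p2 (br p3 p5 p4) = - br p1 p2 (br p3 p4 p5)"
      by (simp add: skew23[of p3 p5 p4] neg)
    also have "\<dots> = - br (br p1 p2 p3) p4 p5 - br p3 (br p1 p2 p4) p5 - br p3 p4 (br p1 p2 p5)"
      using that by (simp add: fundamental_def)
    also have "\<dots> = br (br p1 p2 p3) p5 p4 + br p3 (br p1 p2 p5) p4 + br p3 p5 (br p1 p2 p4)"
      using skew23[of "br p1 p2 p3" p5 p4] skew23[of p3 "br p1 p2 p5" p4] skew23[of p3 p5 "br p1 p2 p4"]
      by simp
    finally show ?thesis by (simp add: fundamental_def)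
  qed
  have AAA: "fundamental br p1 p2 (x3, 0) (x4, 0) (x5, 0)"
    and AAB: "fundamental br p1 p2 (x3, 0) (x4, 0) (0, y5)"
    and ABB: "fundamental br p1 p2 (x3, 0) (0, y4) (0, y5)"
    and BBB: "fundamental br p1 p2 (0, y3) (0, y4) (0, y5)"
    if "p1 \<in> homogeneous" "p2 \<in> homogeneous" for p1 p2 x3 x4 x5 y3 y4 y5
    using that unfolding homogeneous_def
    by (auto intro: assms(4-) swap12[OF AB_AAA] swap12[OF AB_AAB] swap12[OF AB_ABB] swap12[OF AB_BBB])
  have hom: "fundamental br p1 p2 p3 p4 p5"
    if "p1 \<in> homogeneous" "p2 \<in> homogeneous" "p3 \<in> homogeneous" "p4 \<in> homogeneous" "p5 \<in> homogeneous"
    for p1 p2 p3 p4 p5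
  proof -
    \<comment> \<open>Of the eight distributions of the last three arguments, four are not sorted.
      The adjacent exchanges move the lone \<open>B\<close> of \<open>AAB\<close>, respectively the
      lone \<open>A\<close> of \<open>ABB\<close>, to the other two positions.\<close>
    note AAB' = AAB[OF that(1,2)] and ABB' = ABB[OF that(1,2)]
    show ?thesis
      using that(3-5) unfolding homogeneous_def
      by (auto intro: AAA[OF that(1,2)] BBB[OF that(1,2)]
          AAB' swap45[OF AAB'] swap34[OF swap45[OF AAB']]
          ABB' swap34[OF ABB'] swap45[OF swap34[OF ABB']])
  qed
  \<comment> \<open>Homogeneity is dropped one argument at a time, from the fifth to the first.
    Every argument occurs exactly once in each term, so the identity is additive in it.\<close>
  have hom5: "fundamental br p1 p2 p3 p4 p5"
    if "p1 \<in> homogeneous" "p2 \<in> homogeneous" "p3 \<in> homogeneous" "p4 \<in> homogeneous" for p1 p2 p3 p4 p5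
    by (rule homogeneous_additive_induct[of _ p5])
      (simp_all add: hom that, simp add: fundamental_def add ac_simps)
  have hom4: "fundamental br p1 p2 p3 p4 p5"
    if "p1 \<in> homogeneous" "p2 \<in> homogeneous" "p3 \<in> homogeneous" for p1 p2 p3 p4 p5
    by (rule homogeneous_additive_induct[of _ p4])
      (simp_all add: hom5 that, simp add: fundamental_def add ac_simps)
  have hom3: "fundamental br p1 p2 p3 p4 p5"
    if "p1 \<in> homogeneous" "p2 \<in> homogeneous" for p1 p2 p3 p4 p5
    by (rule homogeneous_additive_induct[of _ p3])
      (simp_all add: hom4 that, simp add: fundamental_def add ac_simps)
  have hom2: "fundamental br p1 p2 p3 p4 p5" if "p1 \<in> homogeneous" for p1 p2 p3 p4 p5
    by (rule homogeneous_additive_induct[of _ p2])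
      (simp_all add: hom3 that, simp add: fundamental_def add ac_simps)
  show ?thesis
    by (rule homogeneous_additive_induct[of _ p1])
      (simp_all add: hom2, simp add: fundamental_def add ac_simps)
qed

definition leibniz :: "('v::ab_group_add \<Rightarrow> 'v \<Rightarrow> 'v) \<Rightarrow> ('v \<Rightarrow> 'v \<Rightarrow> 'v \<Rightarrow> 'v) \<Rightarrow> 'v \<Rightarrow> 'v \<Rightarrow> 'v \<Rightarrow> 'v \<Rightarrow> bool"
  where "leibniz mul br w x y z \<longleftrightarrow> br (mul w x) y z = mul w (br x y z) + mul x (br w y z)"

text \<open>Commutativity makes the identity symmetric in its first two arguments, and exchanging
  the last two negates both sides. Three distributions remain for each of these pairs, hence nine
  cases; in a label such as \<open>AB_AA\<close> the first two letters belong to the factors of the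
  product. Additivity then extends the identity to all elements.\<close>

lemma leibniz_prodI:
  fixes br :: "'a::ab_group_add \<times> 'b::ab_group_add \<Rightarrow> 'a \<times> 'b \<Rightarrow> 'a \<times> 'b \<Rightarrow> 'a \<times> 'b"
  assumes lin2: "bilinear_map s s s mul" and lin3: "trilinear_map s s s s br"
    and comm: "\<And>p q. mul p q = mul q p" and skew23: "\<And>p q r. br p q r = - br p r q"
    and AA_AA: "\<And>w x y z. leibniz mul br (w, 0) (x, 0) (y, 0) (z, 0)"
    and AA_AB: "\<And>w x y c. leibniz mul br (w, 0) (x, 0) (y, 0) (0, c)"
    and AA_BB: "\<And>w x b c. leibniz mul br (w, 0) (x, 0) (0, b) (0, c)"
    and AB_AA: "\<And>w a y z. leibniz mul br (w, 0) (0, a) (y, 0) (z, 0)"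
    and AB_AB: "\<And>w a y c. leibniz mul br (w, 0) (0, a) (y, 0) (0, c)"
    and AB_BB: "\<And>w a b c. leibniz mul br (w, 0) (0, a) (0, b) (0, c)"
    and BB_AA: "\<And>d a y z. leibniz mul br (0, d) (0, a) (y, 0) (z, 0)"
    and BB_AB: "\<And>d a y c. leibniz mul br (0, d) (0, a) (y, 0) (0, c)"
    and BB_BB: "\<And>d a b c. leibniz mul br (0, d) (0, a) (0, b) (0, c)"
  shows "leibniz mul br p1 p2 p3 p4"
proof -
  note add = trilinear_map_simps(1-3)[OF lin3] bilinear_map_simps(1,2)[OF lin2]
  note neg = trilinear_map_simps(7-9)[OF lin3] bilinear_map_simps(5,6)[OF lin2]
  have swap12: "leibniz mul br p2 p1 p3 p4" if "leibniz mul br p1 p2 p3 p4" for p1 p2 p3 p4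
    using that by (simp add: leibniz_def comm[of p2 p1] add.commute)
  have swap34: "leibniz mul br p1 p2 p4 p3" if "leibniz mul br p1 p2 p3 p4" for p1 p2 p3 p4
    using that by (simp add: leibniz_def skew23[of _ p4 p3] neg)
  have AA: "leibniz mul br p1 p2 (y, 0) (z, 0)"
    and AB: "leibniz mul br p1 p2 (y, 0) (0, c)"
    and BB: "leibniz mul br p1 p2 (0, b) (0, c)"
    if "p1 \<in> homogeneous" "p2 \<in> homogeneous" for p1 p2 y z b c
    using that unfolding homogeneous_def
    by (auto intro: assms(5-) swap12[OF AB_AA] swap12[OF AB_AB] swap12[OF AB_BB])
  have hom: "leibniz mul br p1 p2 p3 p4"
    if "p1 \<in> homogeneous" "p2 \<in> homogeneous" "p3 \<in> homogeneous" "p4 \<in> homogeneous" for p1 p2 p3 p4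
    using that(3,4) unfolding homogeneous_def
    by (auto intro: AA[OF that(1,2)] BB[OF that(1,2)] AB[OF that(1,2)] swap34[OF AB[OF that(1,2)]])
  have hom4: "leibniz mul br p1 p2 p3 p4"
    if "p1 \<in> homogeneous" "p2 \<in> homogeneous" "p3 \<in> homogeneous" for p1 p2 p3 p4
    by (rule homogeneous_additive_induct[of _ p4])
      (simp_all add: hom that, simp add: leibniz_def add ac_simps)
  have hom3: "leibniz mul br p1 p2 p3 p4"
    if "p1 \<in> homogeneous" "p2 \<in> homogeneous" for p1 p2 p3 p4
    by (rule homogeneous_additive_induct[of _ p3])
      (simp_all add: hom4 that, simp add: leibniz_def add ac_simps)
  have hom2: "leibniz mul br p1 p2 p3 p4" if "p1 \<in> homogeneous" for p1 p2 p3 p4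
    by (rule homogeneous_additive_induct[of _ p2])
      (simp_all add: hom3 that, simp add: leibniz_def add ac_simps)
  show ?thesis
    by (rule homogeneous_additive_induct[of _ p1])
      (simp_all add: hom2, simp add: leibniz_def add ac_simps)
qed

section \<open>The commutative associative structure on the direct sum\<close>

locale comm_assoc_pair =
  A: comm_assoc_algebra scaleA mulA + B: comm_assoc_algebra scaleB mulB
  for scaleA :: "'k::field_char_0 \<Rightarrow> 'a::ab_group_add \<Rightarrow> 'a"
    and mulA :: "'a \<Rightarrow> 'a \<Rightarrow> 'a"
    and scaleB :: "'k \<Rightarrow> 'b::ab_group_add \<Rightarrow> 'b"
    and mulB :: "'b \<Rightarrow> 'b \<Rightarrow> 'b" +
  fixes \<mu>\<^sub>A :: "'a \<Rightarrow> 'b \<Rightarrow> 'b" and \<mu>\<^sub>B :: "'b \<Rightarrow> 'a \<Rightarrow> 'a"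
  assumes muA_bilinear: "bilinear_map scaleA scaleB scaleB \<mu>\<^sub>A"
    and muB_bilinear: "bilinear_map scaleB scaleA scaleA \<mu>\<^sub>B"
begin

sublocale sum: vector_space_prod scaleA scaleB ..

abbreviation mul where "mul \<equiv> direct_sum_mul mulA mulB \<mu>\<^sub>A \<mu>\<^sub>B"

lemmas bilinear_simps =
  bilinear_map_simps[OF A.mul_bilinear] bilinear_map_simps[OF B.mul_bilinear]
  bilinear_map_simps[OF muA_bilinear] bilinear_map_simps[OF muB_bilinear]

lemma fd_vector_space_sum: "fd_vector_space sum.scale"
  by (intro fd_vector_space_prod A.fd_vector_space_axioms B.fd_vector_space_axioms)

lemma direct_sum_mul_bilinear: "bilinear_map sum.scale sum.scale sum.scale mul"
  unfolding bilinear_map_def Vector_Spaces.linear_iff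
  by (auto simp: sum.p.vector_space_axioms direct_sum_mul_def bilinear_simps sum.scale_def
      bilinear_map_scale[OF A.mul_bilinear] bilinear_map_scale[OF B.mul_bilinear]
      bilinear_map_scale[OF muA_bilinear] bilinear_map_scale[OF muB_bilinear]
      A.scale_right_distrib B.scale_right_distrib ac_simps)

text \<open>The formula for the product is symmetric once both algebras are commutative, so only
  associativity imposes conditions on the two actions.\<close>

lemma direct_sum_mul_comm: "mul p q = mul q p"
  by (simp add: direct_sum_mul_def A.mul_comm B.mul_comm ac_simps split: prod.split)

text \<open>Each axiom is one component of associativity on a mixed homogeneous triple. The
  \<open>B\<close>-components give the conditions on the action of A on B, the
  \<open>A\<close>-components those on the action of B on A.\<close>

lemma matched_pair_if_direct_sum:
  assumes "comm_assoc_algebra sum.scale mul"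
  shows "comm_assoc_matched_pair scaleA mulA scaleB mulB \<mu>\<^sub>A \<mu>\<^sub>B"
proof -
  interpret S: comm_assoc_algebra sum.scale mul by fact
  show ?thesis
  proof unfold_locales
    show "\<mu>\<^sub>A (mulA x y) v = \<mu>\<^sub>A x (\<mu>\<^sub>A y v)" for x y v
      using S.mul_assoc[of "(x, 0)" "(y, 0)" "(0, v)"] by (simp add: direct_sum_mul_def bilinear_simps)
    show "\<mu>\<^sub>B (mulB a b) v = \<mu>\<^sub>B a (\<mu>\<^sub>B b v)" for a b v
      using S.mul_assoc[of "(0, a)" "(0, b)" "(v, 0)"] by (simp add: direct_sum_mul_def bilinear_simps)
    show "\<mu>\<^sub>A x (mulB a b) = mulB (\<mu>\<^sub>A x a) b + \<mu>\<^sub>A (\<mu>\<^sub>B a x) b" for x a b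
      using S.mul_assoc[of "(x, 0)" "(0, a)" "(0, b)"] by (simp add: direct_sum_mul_def bilinear_simps)
    show "\<mu>\<^sub>B a (mulA x y) = mulA (\<mu>\<^sub>B a x) y + \<mu>\<^sub>B (\<mu>\<^sub>A x a) y" for a x y
      using S.mul_assoc[of "(0, a)" "(x, 0)" "(y, 0)"] by (simp add: direct_sum_mul_def bilinear_simps)
  qed (fact muA_bilinear muB_bilinear)+
qed

lemma direct_sum_if_matched_pair:
  assumes "comm_assoc_matched_pair scaleA mulA scaleB mulB \<mu>\<^sub>A \<mu>\<^sub>B"
  shows "comm_assoc_algebra sum.scale mul"
proof -
  interpret M: comm_assoc_matched_pair scaleA mulA scaleB mulB \<mu>\<^sub>A \<mu>\<^sub>B by fact
  \<comment> \<open>Associativity is checked componentwise on arbitrary elements, by normalisation.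
    The compatibility axioms are oriented so as to eliminate products having a factor
    \<open>\<mu>\<^sub>B b x\<close> or \<open>\<mu>\<^sub>A x a\<close>, on either side.\<close>
  have A: "mulA (\<mu>\<^sub>B b x) y = \<mu>\<^sub>B b (mulA x y) - \<mu>\<^sub>B (\<mu>\<^sub>A x b) y"
    "mulA y (\<mu>\<^sub>B b x) = \<mu>\<^sub>B b (mulA x y) - \<mu>\<^sub>B (\<mu>\<^sub>A x b) y" for b x y
    using M.muB_mulA[of b x y] by (simp_all add: A.mul_comm)
  have B: "mulB (\<mu>\<^sub>A x a) b = \<mu>\<^sub>A x (mulB a b) - \<mu>\<^sub>A (\<mu>\<^sub>B a x) b"
    "mulB b (\<mu>\<^sub>A x a) = \<mu>\<^sub>A x (mulB a b) - \<mu>\<^sub>A (\<mu>\<^sub>B a x) b" for a b x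
    using M.muA_mulB[of x a b] by (simp_all add: B.mul_comm)
  \<comment> \<open>Permutative rules put iterated products and actions into a canonical order. Two
    actions of the same algebra commute because the action is multiplicative and the algebra
    commutative.\<close>
  have commute: "mulA x y = mulA y x" "mulA x (mulA y z) = mulA y (mulA x z)"
    "mulB a b = mulB b a" "mulB a (mulB b c) = mulB b (mulB a c)"
    "\<mu>\<^sub>A x (\<mu>\<^sub>A y c) = \<mu>\<^sub>A y (\<mu>\<^sub>A x c)" "\<mu>\<^sub>B a (\<mu>\<^sub>B b z) = \<mu>\<^sub>B b (\<mu>\<^sub>B a z)"
    for x y z a b c
    by (metis A.mul_comm A.mul_assoc B.mul_comm B.mul_assoc M.A.mu_mul M.B.mu_mul)+
  have "mul (mul p q) r = mul p (mul q r)" for p q r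
    by (simp add: direct_sum_mul_def bilinear_simps split: prod.split)
      (simp add: A.mul_assoc B.mul_assoc M.A.mu_mul M.B.mu_mul A B commute algebra_simps)
  then show ?thesis
    by (intro comm_assoc_algebra.intro fd_vector_space_sum comm_assoc_algebra_axioms.intro)
      (simp_all add: direct_sum_mul_bilinear direct_sum_mul_comm)
qed

end

section \<open>The 3-Lie structure on the direct sum\<close>

locale three_Lie_pair =
  A: three_Lie_algebra scaleA brA + B: three_Lie_algebra scaleB brB
  for scaleA :: "'k::field_char_0 \<Rightarrow> 'a::ab_group_add \<Rightarrow> 'a"
    and brA :: "'a \<Rightarrow> 'a \<Rightarrow> 'a \<Rightarrow> 'a"
    and scaleB :: "'k \<Rightarrow> 'b::ab_group_add \<Rightarrow> 'b"
    and brB :: "'b \<Rightarrow> 'b \<Rightarrow> 'b \<Rightarrow> 'b" +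
  fixes \<rho>\<^sub>A :: "'a \<Rightarrow> 'a \<Rightarrow> 'b \<Rightarrow> 'b" and \<rho>\<^sub>B :: "'b \<Rightarrow> 'b \<Rightarrow> 'a \<Rightarrow> 'a"
  assumes rhoA_trilinear: "trilinear_map scaleA scaleA scaleB scaleB \<rho>\<^sub>A"
    and rhoB_trilinear: "trilinear_map scaleB scaleB scaleA scaleA \<rho>\<^sub>B"
begin

abbreviation br where "br \<equiv> direct_sum_br brA brB \<rho>\<^sub>A \<rho>\<^sub>B"

sublocale sum: vector_space_prod scaleA scaleB ..

lemmas trilinear_simps =
  trilinear_map_simps[OF A.br_trilinear] trilinear_map_simps[OF B.br_trilinear]
  trilinear_map_simps[OF rhoA_trilinear] trilinear_map_simps[OF rhoB_trilinear]

lemma fd_vector_space_sum: "fd_vector_space sum.scale"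
  by (intro fd_vector_space_prod A.fd_vector_space_axioms B.fd_vector_space_axioms)

lemma direct_sum_br_trilinear: "trilinear_map sum.scale sum.scale sum.scale sum.scale br"
  unfolding trilinear_map_def Vector_Spaces.linear_iff
  by (auto simp: sum.p.vector_space_axioms direct_sum_br_def trilinear_simps sum.scale_def
      trilinear_map_scale[OF A.br_trilinear] trilinear_map_scale[OF B.br_trilinear]
      trilinear_map_scale[OF rhoA_trilinear] trilinear_map_scale[OF rhoB_trilinear]
      A.scale_right_distrib B.scale_right_distrib ac_simps)

text \<open>The parity of the number of arguments from B decides the summand of the result: the
  bracket is graded modulo 2, with A even and B odd. Hence the fundamental identity on homogeneous
  elements lives in a single summand and amounts to one equation.\<close>

lemma direct_sum_br_homogeneous:
  "br (x1, 0) (x2, 0) (x3, 0) = (brA x1 x2 x3, 0)"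
  "br (x1, 0) (x2, 0) (0, y3) = (0, \<rho>\<^sub>A x1 x2 y3)"
  "br (x1, 0) (0, y2) (x3, 0) = (0, \<rho>\<^sub>A x3 x1 y2)"
  "br (0, y1) (x2, 0) (x3, 0) = (0, \<rho>\<^sub>A x2 x3 y1)"
  "br (x1, 0) (0, y2) (0, y3) = (\<rho>\<^sub>B y2 y3 x1, 0)"
  "br (0, y1) (x2, 0) (0, y3) = (\<rho>\<^sub>B y3 y1 x2, 0)"
  "br (0, y1) (0, y2) (x3, 0) = (\<rho>\<^sub>B y1 y2 x3, 0)"
  "br (0, y1) (0, y2) (0, y3) = (0, brB y1 y2 y3)"
  by (simp_all add: direct_sum_br_def trilinear_simps)

lemma brA_cyclic: "brA x y z = brA y z x"
  using A.br_skew12[of x y z] A.br_skew23[of y x z] by simp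

lemma brB_cyclic: "brB x y z = brB y z x"
  using B.br_skew12[of x y z] B.br_skew23[of y x z] by simp

text \<open>Skew-symmetry of the two actions is a local assumption because it belongs to both sides
  of the equivalence: one direction extracts it from the bracket on the sum, the other from the
  representation axioms.\<close>

context
  assumes rhoA_skew: "\<And>x y v. \<rho>\<^sub>A x y v = - \<rho>\<^sub>A y x v"
    and rhoB_skew: "\<And>a b v. \<rho>\<^sub>B a b v = - \<rho>\<^sub>B b a v"
begin

lemma direct_sum_br_skew:
  "br p q r = - br q p r" "br p q r = - br p r q"
proof -
  obtain x1 y1 x2 y2 x3 y3 where p: "p = (x1, y1)" "q = (x2, y2)" "r = (x3, y3)"
    by (metis surj_pair)
  show "br p q r = - br q p r"
    using A.br_skew12[of x1 x2 x3] B.br_skew12[of y1 y2 y3]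
      rhoA_skew[of x1 x2] rhoA_skew[of x2 x3] rhoA_skew[of x3 x1]
      rhoB_skew[of y1 y2] rhoB_skew[of y2 y3] rhoB_skew[of y3 y1]
    by (simp add: p direct_sum_br_def)
  show "br p q r = - br p r q"
    using A.br_skew23[of x1 x2 x3] B.br_skew23[of y1 y2 y3]
      rhoA_skew[of x1 x2] rhoA_skew[of x2 x3] rhoA_skew[of x3 x1]
      rhoB_skew[of y1 y2] rhoB_skew[of y2 y3] rhoB_skew[of y3 y1]
    by (simp add: p direct_sum_br_def)
qed

text \<open>This and the following nine equivalences match the ten mixed distributions with the four
  representation axioms and the six compatibility conditions of a matched pair. Variables are
  numbered as in the axiom, not by position in the identity, so that the two agree
  literally.\<close>

lemma fundamental_AA_AAB_iff:
  "fundamental br (x1, 0) (x2, 0) (x3, 0) (x4, 0) (0, v) \<longleftrightarrow>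
    \<rho>\<^sub>A x1 x2 (\<rho>\<^sub>A x3 x4 v) - \<rho>\<^sub>A x3 x4 (\<rho>\<^sub>A x1 x2 v) =
      \<rho>\<^sub>A (brA x1 x2 x3) x4 v - \<rho>\<^sub>A (brA x1 x2 x4) x3 v"
  by (simp add: fundamental_def direct_sum_br_homogeneous rhoA_skew[of x3 "brA x1 x2 x4"] algebra_simps)

lemma fundamental_BB_ABB_iff:
  "fundamental br (0, y1) (0, y2) (v, 0) (0, y3) (0, y4) \<longleftrightarrow>
    \<rho>\<^sub>B y1 y2 (\<rho>\<^sub>B y3 y4 v) - \<rho>\<^sub>B y3 y4 (\<rho>\<^sub>B y1 y2 v) =
      \<rho>\<^sub>B (brB y1 y2 y3) y4 v - \<rho>\<^sub>B (brB y1 y2 y4) y3 v"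
  by (simp add: fundamental_def direct_sum_br_homogeneous rhoB_skew[of y3 "brB y1 y2 y4"] algebra_simps)

lemma fundamental_AB_AAA_iff:
  "fundamental br (x4, 0) (0, v) (x1, 0) (x2, 0) (x3, 0) \<longleftrightarrow>
    \<rho>\<^sub>A (brA x1 x2 x3) x4 v =
      \<rho>\<^sub>A x1 x2 (\<rho>\<^sub>A x3 x4 v) + \<rho>\<^sub>A x2 x3 (\<rho>\<^sub>A x1 x4 v) + \<rho>\<^sub>A x3 x1 (\<rho>\<^sub>A x2 x4 v)"
  by (simp add: fundamental_def direct_sum_br_homogeneous algebra_simps)

text \<open>In contrast to \<open>fundamental_AB_AAA_iff\<close>, the vector \<open>v\<close> acted
  upon stands before \<open>y4\<close>. This reverses the arguments of \<open>\<rho>\<^sub>B\<close>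
  once in each term, so the axiom appears with both sides negated.\<close>

lemma fundamental_AB_BBB_iff:
  "fundamental br (v, 0) (0, y4) (0, y1) (0, y2) (0, y3) \<longleftrightarrow>
    \<rho>\<^sub>B (brB y1 y2 y3) y4 v =
      \<rho>\<^sub>B y1 y2 (\<rho>\<^sub>B y3 y4 v) + \<rho>\<^sub>B y2 y3 (\<rho>\<^sub>B y1 y4 v) + \<rho>\<^sub>B y3 y1 (\<rho>\<^sub>B y2 y4 v)"
  by (simp add: fundamental_def direct_sum_br_homogeneous rhoB_skew[of y4] trilinear_simps
      minus_equation_iff[of "\<rho>\<^sub>B (brB y1 y2 y3) y4 v"] algebra_simps) (auto simp: algebra_simps)

lemma fundamental_BB_AAA_iff:
  "fundamental br (0, y4) (0, y5) (x1, 0) (x2, 0) (x3, 0) \<longleftrightarrow>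
    \<rho>\<^sub>B y4 y5 (brA x1 x2 x3) =
      brA (\<rho>\<^sub>B y4 y5 x1) x2 x3 + brA x1 (\<rho>\<^sub>B y4 y5 x2) x3 + brA x1 x2 (\<rho>\<^sub>B y4 y5 x3)"
  by (simp add: fundamental_def direct_sum_br_homogeneous)

lemma fundamental_AA_BBB_iff:
  "fundamental br (x4, 0) (x5, 0) (0, y1) (0, y2) (0, y3) \<longleftrightarrow>
    \<rho>\<^sub>A x4 x5 (brB y1 y2 y3) =
      brB (\<rho>\<^sub>A x4 x5 y1) y2 y3 + brB y1 (\<rho>\<^sub>A x4 x5 y2) y3 + brB y1 y2 (\<rho>\<^sub>A x4 x5 y3)"
  by (simp add: fundamental_def direct_sum_br_homogeneous)

lemma fundamental_AB_AAB_iff: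
  "fundamental br (x4, 0) (0, y5) (x1, 0) (x2, 0) (0, y3) \<longleftrightarrow>
    - \<rho>\<^sub>B (\<rho>\<^sub>A x1 x2 y3) y5 x4 =
      - \<rho>\<^sub>B (\<rho>\<^sub>A x1 x4 y5) y3 x2 + \<rho>\<^sub>B (\<rho>\<^sub>A x2 x4 y5) y3 x1 - brA x1 x2 (\<rho>\<^sub>B y3 y5 x4)"
  by (simp add: fundamental_def direct_sum_br_homogeneous rhoB_skew[of y5] rhoB_skew[of y3 "\<rho>\<^sub>A x1 x4 y5"]
      trilinear_simps)

lemma fundamental_AB_ABB_iff:
  "fundamental br (x5, 0) (0, y4) (x3, 0) (0, y1) (0, y2) \<longleftrightarrow>
    - \<rho>\<^sub>A (\<rho>\<^sub>B y1 y2 x3) x5 y4 =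
      - \<rho>\<^sub>A (\<rho>\<^sub>B y1 y4 x5) x3 y2 + \<rho>\<^sub>A (\<rho>\<^sub>B y2 y4 x5) x3 y1 - brB y1 y2 (\<rho>\<^sub>A x3 x5 y4)"
  by (simp add: fundamental_def direct_sum_br_homogeneous rhoB_skew[of y4]
      rhoA_skew[of x3] brB_cyclic[of "\<rho>\<^sub>A x5 x3 y4"] trilinear_simps)
    (auto simp: algebra_simps)

text \<open>The bracket with \<open>x4\<close> and \<open>x5\<close> is applied to
  \<open>\<rho>\<^sub>B y2 y3 x1\<close>. A cyclic permutation, being even, moves these two entries
  behind the third without a sign.\<close>

lemma fundamental_AA_ABB_iff:
  "fundamental br (x4, 0) (x5, 0) (x1, 0) (0, y2) (0, y3) \<longleftrightarrow>
    brA (\<rho>\<^sub>B y2 y3 x1) x4 x5 =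
      \<rho>\<^sub>B y2 y3 (brA x1 x4 x5) + \<rho>\<^sub>B (\<rho>\<^sub>A x4 x5 y2) y3 x1 + \<rho>\<^sub>B y2 (\<rho>\<^sub>A x4 x5 y3) x1"
  by (simp add: fundamental_def direct_sum_br_homogeneous brA_cyclic[of _ x4 x5])

lemma fundamental_BB_AAB_iff:
  "fundamental br (0, y4) (0, y5) (x2, 0) (x3, 0) (0, y1) \<longleftrightarrow>
    brB (\<rho>\<^sub>A x2 x3 y1) y4 y5 =
      \<rho>\<^sub>A x2 x3 (brB y1 y4 y5) + \<rho>\<^sub>A (\<rho>\<^sub>B y4 y5 x2) x3 y1 + \<rho>\<^sub>A x2 (\<rho>\<^sub>B y4 y5 x3) y1"
  by (simp add: fundamental_def direct_sum_br_homogeneous brB_cyclic[of _ y4 y5] ac_simps)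

end

lemma matched_pair_if_direct_sum:
  assumes "three_Lie_algebra sum.scale br"
  shows "three_Lie_matched_pair scaleA brA scaleB brB \<rho>\<^sub>A \<rho>\<^sub>B"
proof -
  interpret S: three_Lie_algebra sum.scale br by fact
  \<comment> \<open>Skew-symmetry of the actions is read off mixed triples first, since all the
    equivalences presuppose it.\<close>
  have skewA: "\<rho>\<^sub>A x y v = - \<rho>\<^sub>A y x v" for x y v
    using S.br_skew12[of "(x, 0)" "(y, 0)" "(0, v)"] by (simp add: direct_sum_br_homogeneous)
  have skewB: "\<rho>\<^sub>B a b v = - \<rho>\<^sub>B b a v" for a b v
    using S.br_skew12[of "(0, a)" "(0, b)" "(v, 0)"] by (simp add: direct_sum_br_homogeneous)
  note skew = skewA skewB
  have fundamental: "fundamental br p1 p2 p3 p4 p5" for p1 p2 p3 p4 p5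
    unfolding fundamental_def by (rule S.br_fundamental)
  interpret RA: three_Lie_rep scaleA brA scaleB \<rho>\<^sub>A
    by unfold_locales
      (fact rhoA_trilinear skewA iffD1[OF fundamental_AA_AAB_iff[OF skew] fundamental]
        iffD1[OF fundamental_AB_AAA_iff[OF skew] fundamental])+
  interpret RB: three_Lie_rep scaleB brB scaleA \<rho>\<^sub>B
    by unfold_locales
      (fact rhoB_trilinear skewB iffD1[OF fundamental_BB_ABB_iff[OF skew] fundamental]
        iffD1[OF fundamental_AB_BBB_iff[OF skew] fundamental])+
  show ?thesis
    by unfold_locales
      (fact iffD1[OF fundamental_BB_AAA_iff[OF skew] fundamental]
        iffD1[OF fundamental_AB_AAB_iff[OF skew] fundamental]
        iffD1[OF fundamental_AA_ABB_iff[OF skew] fundamental]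
        iffD1[OF fundamental_AA_BBB_iff[OF skew] fundamental]
        iffD1[OF fundamental_AB_ABB_iff[OF skew] fundamental]
        iffD1[OF fundamental_BB_AAB_iff[OF skew] fundamental])+
qed

lemma direct_sum_if_matched_pair:
  assumes "three_Lie_matched_pair scaleA brA scaleB brB \<rho>\<^sub>A \<rho>\<^sub>B"
  shows "three_Lie_algebra sum.scale br"
proof -
  interpret M: three_Lie_matched_pair scaleA brA scaleB brB \<rho>\<^sub>A \<rho>\<^sub>B by fact
  note skew = M.A.rho_skew M.B.rho_skew
  have "fundamental br p1 p2 p3 p4 p5" for p1 p2 p3 p4 p5
  \<comment> \<open>The two pure cases are the fundamental identities of A and B; the ten mixed ones
    are the equivalences read from right to left.\<close>
  proof (rule fundamental_prodI[OF direct_sum_br_trilinear direct_sum_br_skew[OF skew]])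
    show "fundamental br (x1, 0) (x2, 0) (x3, 0) (x4, 0) (x5, 0)" for x1 x2 x3 x4 x5
      by (simp add: fundamental_def direct_sum_br_homogeneous A.br_fundamental[of x1 x2 x3 x4 x5])
    show "fundamental br (0, y1) (0, y2) (0, y3) (0, y4) (0, y5)" for y1 y2 y3 y4 y5
      by (simp add: fundamental_def direct_sum_br_homogeneous B.br_fundamental[of y1 y2 y3 y4 y5])
  qed (rule iffD2[OF fundamental_AA_AAB_iff[OF skew] M.A.rho_commutator]
      iffD2[OF fundamental_AA_ABB_iff[OF skew] M.brA_rhoB]
      iffD2[OF fundamental_AA_BBB_iff[OF skew] M.rhoA_brB]
      iffD2[OF fundamental_AB_AAA_iff[OF skew] M.A.rho_br]
      iffD2[OF fundamental_AB_AAB_iff[OF skew] M.rhoB_rhoA]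
      iffD2[OF fundamental_AB_ABB_iff[OF skew] M.rhoA_rhoB]
      iffD2[OF fundamental_AB_BBB_iff[OF skew] M.B.rho_br]
      iffD2[OF fundamental_BB_AAA_iff[OF skew] M.rhoB_brA]
      iffD2[OF fundamental_BB_AAB_iff[OF skew] M.brB_rhoA]
      iffD2[OF fundamental_BB_ABB_iff[OF skew] M.B.rho_commutator])+
  then show ?thesis
    unfolding fundamental_def
    by (intro three_Lie_algebra.intro fd_vector_space_sum three_Lie_algebra_axioms.intro
        direct_sum_br_trilinear direct_sum_br_skew[OF skew])
qed

end

section \<open>The Leibniz rule and the Poisson structure on the direct sum\<close>

locale Poisson_three_Lie_pair =
  A: Poisson_three_Lie_algebra scaleA mulA brA + B: Poisson_three_Lie_algebra scaleB mulB brB +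
  assoc: comm_assoc_pair scaleA mulA scaleB mulB \<mu>\<^sub>A \<mu>\<^sub>B +
  Lie: three_Lie_pair scaleA brA scaleB brB \<rho>\<^sub>A \<rho>\<^sub>B
  for scaleA :: "'k::field_char_0 \<Rightarrow> 'a::ab_group_add \<Rightarrow> 'a"
    and mulA :: "'a \<Rightarrow> 'a \<Rightarrow> 'a"
    and brA :: "'a \<Rightarrow> 'a \<Rightarrow> 'a \<Rightarrow> 'a"
    and scaleB :: "'k \<Rightarrow> 'b::ab_group_add \<Rightarrow> 'b"
    and mulB :: "'b \<Rightarrow> 'b \<Rightarrow> 'b"
    and brB :: "'b \<Rightarrow> 'b \<Rightarrow> 'b \<Rightarrow> 'b"
    and \<rho>\<^sub>A :: "'a \<Rightarrow> 'a \<Rightarrow> 'b \<Rightarrow> 'b"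
    and \<mu>\<^sub>A :: "'a \<Rightarrow> 'b \<Rightarrow> 'b"
    and \<rho>\<^sub>B :: "'b \<Rightarrow> 'b \<Rightarrow> 'a \<Rightarrow> 'a"
    and \<mu>\<^sub>B :: "'b \<Rightarrow> 'a \<Rightarrow> 'a"
begin

abbreviation sum_leibniz where "sum_leibniz \<equiv> leibniz assoc.mul Lie.br"

lemmas leibniz_simps =
  leibniz_def direct_sum_mul_def direct_sum_br_def assoc.bilinear_simps Lie.trilinear_simps

text \<open>Unlike the bracket, the product is not graded: a mixed product has components in both
  summands, so one identity may yield two axioms. Here the left side lies in B, and the vanishing of
  the \<open>A\<close>-component on the right is the second condition.\<close>

lemma leibniz_AA_AB_iff:
  "sum_leibniz (x, 0) (y, 0) (z, 0) (0, v) \<longleftrightarrow>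
    \<rho>\<^sub>A (mulA x y) z v = \<mu>\<^sub>A x (\<rho>\<^sub>A y z v) + \<mu>\<^sub>A y (\<rho>\<^sub>A x z v) \<and>
    \<mu>\<^sub>B (\<rho>\<^sub>A y z v) x + \<mu>\<^sub>B (\<rho>\<^sub>A x z v) y = 0"
  by (auto simp: leibniz_simps)

lemma leibniz_AA_BB_iff:
  "sum_leibniz (x1, 0) (x2, 0) (0, y3) (0, y4) \<longleftrightarrow>
    \<rho>\<^sub>B y3 y4 (mulA x1 x2) = mulA x1 (\<rho>\<^sub>B y3 y4 x2) + mulA x2 (\<rho>\<^sub>B y3 y4 x1)"
  by (simp add: leibniz_simps)

lemma leibniz_BB_AA_iff:
  "sum_leibniz (0, y1) (0, y2) (x3, 0) (x4, 0) \<longleftrightarrow>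
    \<rho>\<^sub>A x3 x4 (mulB y1 y2) = mulB y1 (\<rho>\<^sub>A x3 x4 y2) + mulB y2 (\<rho>\<^sub>A x3 x4 y1)"
  by (simp add: leibniz_simps)

lemma leibniz_AB_AA_iff:
  "sum_leibniz (x1, 0) (0, y1) (x2, 0) (x3, 0) \<longleftrightarrow>
    \<rho>\<^sub>A x2 x3 (\<mu>\<^sub>A x1 y1) = \<mu>\<^sub>A (brA x2 x3 x1) y1 + \<mu>\<^sub>A x1 (\<rho>\<^sub>A x2 x3 y1) \<and>
    brA (\<mu>\<^sub>B y1 x1) x2 x3 = \<mu>\<^sub>B (\<rho>\<^sub>A x2 x3 y1) x1 + \<mu>\<^sub>B y1 (brA x1 x2 x3)"
  by (auto simp: leibniz_simps Lie.brA_cyclic[of x1 x2 x3] ac_simps)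

lemma leibniz_AB_BB_iff:
  "sum_leibniz (x1, 0) (0, y1) (0, y2) (0, y3) \<longleftrightarrow>
    \<rho>\<^sub>B y2 y3 (\<mu>\<^sub>B y1 x1) = \<mu>\<^sub>B (brB y2 y3 y1) x1 + \<mu>\<^sub>B y1 (\<rho>\<^sub>B y2 y3 x1) \<and>
    brB (\<mu>\<^sub>A x1 y1) y2 y3 = \<mu>\<^sub>A (\<rho>\<^sub>B y2 y3 x1) y1 + \<mu>\<^sub>A x1 (brB y1 y2 y3)"
  by (auto simp: leibniz_simps Lie.brB_cyclic[of y1 y2 y3] ac_simps)

context
  assumes rhoA_skew: "\<And>x y v. \<rho>\<^sub>A x y v = - \<rho>\<^sub>A y x v"
    and rhoB_skew: "\<And>a b v. \<rho>\<^sub>B a b v = - \<rho>\<^sub>B b a v"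
begin

text \<open>On the left the mixed product contributes to both summands, while on the right each
  product has its two factors in the same summand. Comparing components thus separates the two
  conditions.\<close>

lemma leibniz_AB_AB_iff:
  "sum_leibniz (x1, 0) (0, y1) (x2, 0) (0, y2) \<longleftrightarrow>
    \<rho>\<^sub>B (\<mu>\<^sub>A x1 y1) y2 x2 = mulA x1 (\<rho>\<^sub>B y1 y2 x2) \<and>
    \<rho>\<^sub>A (\<mu>\<^sub>B y1 x1) x2 y2 = mulB y1 (\<rho>\<^sub>A x1 x2 y2)"
  by (simp add: leibniz_simps rhoB_skew[of y2])

lemma leibniz_BB_AB_iff:
  "sum_leibniz (0, a) (0, b) (v, 0) (0, c) \<longleftrightarrow>
    \<rho>\<^sub>B (mulB a b) c v = \<mu>\<^sub>B a (\<rho>\<^sub>B b c v) + \<mu>\<^sub>B b (\<rho>\<^sub>B a c v) \<and>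
    \<mu>\<^sub>A (\<rho>\<^sub>B b c v) a + \<mu>\<^sub>A (\<rho>\<^sub>B a c v) b = 0"
proof -
  \<comment> \<open>With \<open>v\<close> before \<open>c\<close>, the action occurs as
    \<open>\<rho>\<^sub>B c b\<close> and \<open>\<rho>\<^sub>B c a\<close>. Skew-symmetry
    introduces signs in both components, which these two facts about abelian groups remove.\<close>
  have "- r = - p - q \<longleftrightarrow> r = p + q" for p q r :: 'a
    by (metis diff_conv_add_uminus minus_add_distrib neg_equal_iff_equal)
  moreover have "- p = q \<longleftrightarrow> p + q = 0" for p q :: 'b
    by (metis neg_eq_iff_add_eq_0)
  ultimately show ?thesis
    by (simp add: leibniz_simps rhoB_skew[of c])
qed

end

lemma direct_sum_iff_matched_pair:
  "Poisson_three_Lie_algebra (module_prod.scale scaleA scaleB) assoc.mul Lie.br \<longleftrightarrow>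
   Poisson_three_Lie_matched_pair scaleA mulA brA scaleB mulB brB \<rho>\<^sub>A \<mu>\<^sub>A \<rho>\<^sub>B \<mu>\<^sub>B"
proof
  assume "Poisson_three_Lie_algebra (module_prod.scale scaleA scaleB) assoc.mul Lie.br"
  then interpret S: Poisson_three_Lie_algebra "module_prod.scale scaleA scaleB" assoc.mul Lie.br .
  \<comment> \<open>The two underlying matched pairs come first, because the second supplies the
    skew-symmetry under which the Leibniz equivalences hold.\<close>
  interpret M1: comm_assoc_matched_pair scaleA mulA scaleB mulB \<mu>\<^sub>A \<mu>\<^sub>B
    by (rule assoc.matched_pair_if_direct_sum) unfold_locales
  interpret M2: three_Lie_matched_pair scaleA brA scaleB brB \<rho>\<^sub>A \<rho>\<^sub>B
    by (rule Lie.matched_pair_if_direct_sum) unfold_locales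
  note skew = M2.A.rho_skew M2.B.rho_skew
  have leibniz: "sum_leibniz p q r s" for p q r s
    unfolding leibniz_def by (rule S.Leibniz)
  \<comment> \<open>The seven mixed cases of the Leibniz rule yield twelve equations: for each of
    the two representations the two axioms linking \<open>\<rho>\<close> and \<open>\<mu>\<close>,
    and the eight compatibility conditions of the Poisson matched pair.\<close>
  note AA_AB = iffD1[OF leibniz_AA_AB_iff leibniz] and AB_AA = iffD1[OF leibniz_AB_AA_iff leibniz]
    and AB_AB = iffD1[OF leibniz_AB_AB_iff[OF skew] leibniz]
    and AB_BB = iffD1[OF leibniz_AB_BB_iff leibniz]
    and BB_AB = iffD1[OF leibniz_BB_AB_iff[OF skew] leibniz]
  show "Poisson_three_Lie_matched_pair scaleA mulA brA scaleB mulB brB \<rho>\<^sub>A \<mu>\<^sub>A \<rho>\<^sub>B \<mu>\<^sub>B"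
    by unfold_locales
      (fact AA_AB[THEN conjunct1] AA_AB[THEN conjunct2] AB_AA[THEN conjunct1] AB_AA[THEN conjunct2]
        AB_AB[THEN conjunct1] AB_AB[THEN conjunct2] AB_BB[THEN conjunct1] AB_BB[THEN conjunct2]
        BB_AB[THEN conjunct1] BB_AB[THEN conjunct2]
        iffD1[OF leibniz_AA_BB_iff leibniz] iffD1[OF leibniz_BB_AA_iff leibniz])+
next
  assume "Poisson_three_Lie_matched_pair scaleA mulA brA scaleB mulB brB \<rho>\<^sub>A \<mu>\<^sub>A \<rho>\<^sub>B \<mu>\<^sub>B"
  then interpret M: Poisson_three_Lie_matched_pair scaleA mulA brA scaleB mulB brB
    \<rho>\<^sub>A \<mu>\<^sub>A \<rho>\<^sub>B \<mu>\<^sub>B .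
  note skew = M.A.Lie.rho_skew M.B.Lie.rho_skew
  interpret S1: comm_assoc_algebra "module_prod.scale scaleA scaleB" assoc.mul
    by (rule assoc.direct_sum_if_matched_pair) unfold_locales
  interpret S2: three_Lie_algebra "module_prod.scale scaleA scaleB" Lie.br
    by (rule Lie.direct_sum_if_matched_pair) unfold_locales
  have "sum_leibniz p1 p2 p3 p4" for p1 p2 p3 p4
  proof (rule leibniz_prodI[OF S1.mul_bilinear S2.br_trilinear S1.mul_comm S2.br_skew23])
    show "sum_leibniz (w, 0) (x, 0) (y, 0) (z, 0)" for w x y z
      by (simp add: leibniz_simps A.Leibniz)
    show "sum_leibniz (0, d) (0, a) (0, b) (0, c)" for d a b c
      by (simp add: leibniz_simps B.Leibniz)
  qed (simp_all only: leibniz_AA_AB_iff leibniz_AA_BB_iff leibniz_AB_AA_iff leibniz_AB_AB_iff[OF skew]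
      leibniz_AB_BB_iff leibniz_BB_AA_iff leibniz_BB_AB_iff[OF skew],
      (intro conjI M.A.rho_mul M.A.rho_mu M.B.rho_mul M.B.rho_mu M.brA_muB M.brB_muA M.rhoB_muA
        M.rhoA_muB M.muB_rhoA M.muA_rhoB M.rhoB_mulA M.rhoA_mulB)+)
  then show "Poisson_three_Lie_algebra (module_prod.scale scaleA scaleB) assoc.mul Lie.br"
    unfolding leibniz_def by unfold_locales
qed

end

theorem theorem4p10:
  fixes scaleA :: "'k::field_char_0 \<Rightarrow> 'a::ab_group_add \<Rightarrow> 'a"
    and mulA :: "'a \<Rightarrow> 'a \<Rightarrow> 'a"
    and brA :: "'a \<Rightarrow> 'a \<Rightarrow> 'a \<Rightarrow> 'a"
    and scaleB :: "'k \<Rightarrow> 'b::ab_group_add \<Rightarrow> 'b"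
    and mulB :: "'b \<Rightarrow> 'b \<Rightarrow> 'b"
    and brB :: "'b \<Rightarrow> 'b \<Rightarrow> 'b \<Rightarrow> 'b"
    and \<rho>\<^sub>A :: "'a \<Rightarrow> 'a \<Rightarrow> 'b \<Rightarrow> 'b"
    and \<mu>\<^sub>A :: "'a \<Rightarrow> 'b \<Rightarrow> 'b"
    and \<rho>\<^sub>B :: "'b \<Rightarrow> 'b \<Rightarrow> 'a \<Rightarrow> 'a"
    and \<mu>\<^sub>B :: "'b \<Rightarrow> 'a \<Rightarrow> 'a"
  assumes "Poisson_three_Lie_algebra scaleA mulA brA"
    and "Poisson_three_Lie_algebra scaleB mulB brB"
    and "bilinear_map scaleA scaleB scaleB \<mu>\<^sub>A"
    and "trilinear_map scaleA scaleA scaleB scaleB \<rho>\<^sub>A"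
    and "bilinear_map scaleB scaleA scaleA \<mu>\<^sub>B"
    and "trilinear_map scaleB scaleB scaleA scaleA \<rho>\<^sub>B"
  shows "Poisson_three_Lie_algebra (module_prod.scale scaleA scaleB)
           (direct_sum_mul mulA mulB \<mu>\<^sub>A \<mu>\<^sub>B) (direct_sum_br brA brB \<rho>\<^sub>A \<rho>\<^sub>B) \<longleftrightarrow>
         Poisson_three_Lie_matched_pair scaleA mulA brA scaleB mulB brB \<rho>\<^sub>A \<mu>\<^sub>A \<rho>\<^sub>B \<mu>\<^sub>B"
proof -
  interpret A: Poisson_three_Lie_algebra scaleA mulA brA by fact
  interpret B: Poisson_three_Lie_algebra scaleB mulB brB by fact
  interpret Poisson_three_Lie_pair scaleA mulA brA scaleB mulB brB \<rho>\<^sub>A \<mu>\<^sub>A \<rho>\<^sub>B \<mu>\<^sub>B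
    by unfold_locales (fact assms)+
  show ?thesis by (rule direct_sum_iff_matched_pair)
qed

end
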